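(* The number of $132$-avoiding permutations in $\mathfrak{S}_n(132)$ that avoid the consecutive pattern $123$ and have $q$ descents is given by $$\sum_{i=0}^{2}\left\{\binom{n}{q}-i\binom{n}{q-1}\right\}\kappa_2(n-q-i,q-1).$$ Moreover, $$M_n=\sum_{q}\sum_{i=0}^{2}\left\{\binom{n}{q}-i\binom{n}{q-1}\right\}\kappa_2(n-q-i,q-1).$$
   Context: $\mathfrak{S}_n(132)$ is the set of permutations $\pi=\pi_1\cdots\pi_n$ of $[n]=\{1,\dots,n\}$ avoiding the pattern $132$ (no $a<b<c$ with $\pi_a<\pi_c<\pi_b$). $\pi$ avoids the consecutive pattern $123$ if there is no $a$ with $\pi_a<\pi_{a+1}<\pi_{a+2}$. A descent of $\pi$ is an index $1\le a<n$ with $\pi_a>\pi_{a+1}$, and in addition the index $n$ is always counted as a descent. For $t\ge0$ and $m\ge0$, $\kappa_t(N,m)$ is the number of weak compositions of $N$ into $m$ parts each no larger than $t$, i.e., the number of $m$-tuples $(a_1,\dots,a_m)$ of integers with $0\le a_i\le t$ and $a_1+\cdots+a_m=N$; by convention $\kappa_t(0,0)=1$, and $\kappa_t(N,m)=0$ if $N<0$. The Motzkin numbers $M_n$ are defined by $\sum_{n\ge0}M_nx^n=\frac{1-x-\sqrt{1-2x-3x^2}}{2x^2}$.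
   Formalization: In both formulas the upper limit 2 of the sum over i and κ_2 are replaced by 1 and κ_1; as printed the count fails for n=3, q=1 (gives 1, true count 0). Stated for n≥1 and q≥1, with q summed from 1 to n. *)

theory Defs
  imports
    Complex_Main
    "HOL-Combinatorics.Permutations"
    "HOL-Computational_Algebra.Formal_Power_Series"
begin

text \<open>A permutation of \<open>[n] = {1..n}\<close> is a function \<open>\<pi>\<close> with \<open>\<pi> permutes {1..n}\<close>
  (the identity outside \<open>[n]\<close>), so counting such functions counts permutations.\<close>

definition avoids_132 :: "nat \<Rightarrow> (nat \<Rightarrow> nat) \<Rightarrow> bool" where
  "avoids_132 n \<pi> \<longleftrightarrow>
     \<not> (\<exists>a b c. 1 \<le> a \<and> a < b \<and> b < c \<and> c \<le> n \<and> \<pi> a < \<pi> c \<and> \<pi> c < \<pi> b)"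

definition perms_avoiding_132 :: "nat \<Rightarrow> (nat \<Rightarrow> nat) set" where
  "perms_avoiding_132 n = {\<pi>. \<pi> permutes {1..n} \<and> avoids_132 n \<pi>}"

definition avoids_consecutive_123 :: "nat \<Rightarrow> (nat \<Rightarrow> nat) \<Rightarrow> bool" where
  "avoids_consecutive_123 n \<pi> \<longleftrightarrow>
     \<not> (\<exists>a. 1 \<le> a \<and> a + 2 \<le> n \<and> \<pi> a < \<pi> (a + 1) \<and> \<pi> (a + 1) < \<pi> (a + 2))"

text \<open>The last index \<open>n\<close> always counts as a descent.\<close>

definition descents :: "nat \<Rightarrow> (nat \<Rightarrow> nat) \<Rightarrow> nat set" where
  "descents n \<pi> = {a \<in> {1..n}. a = n \<or> \<pi> a > \<pi> (a + 1)}"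

text \<open>The number of weak compositions of \<open>N\<close> into \<open>m\<close> parts, each at most \<open>t\<close>. The argument \<open>N\<close>
  is an integer so that negative \<open>N\<close> gives 0; the empty list gives \<open>kappa t 0 0 = 1\<close>.

  Ascending runs of a permutation that avoids the consecutive pattern 123 have length
  at most 2, that is, 1 plus an excess of at most 1, and so the bound that belongs to this
  pattern is \<open>t = 1\<close>. The source prints \<open>t = 2\<close> (with \<open>i\<close> ranging up to 2), which fails
  already for \<open>n = 3\<close>: it gives 1 instead of 0 permutations with \<open>q = 1\<close>, and
  5 instead of the Motzkin number 4 in total.\<close>

definition kappa :: "nat \<Rightarrow> int \<Rightarrow> nat \<Rightarrow> nat" where
  "kappa t N m =
     card {as :: nat list. length as = m \<and> (\<forall>a\<in>set as. a \<le> t) \<and> int (sum_list as) = N}"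

text \<open>The square root is the formal one with constant coefficient \<open>sqrt 1 = 1\<close>; its
  difference from \<open>1 - x\<close> is divisible by \<open>x\<^sup>2\<close>, so the division is exact.\<close>

definition motzkin_gf :: "real fps" where
  "motzkin_gf =
     (1 - fps_X - fps_radical (\<lambda>k x. root k x) 2 (1 - 2 * fps_X - 3 * fps_X ^ 2)) / (2 * fps_X ^ 2)"

definition motzkin :: "nat \<Rightarrow> real" where
  "motzkin n = fps_nth motzkin_gf n"

end

theory Submission
  imports Defs
begin

text \<open>
  A 132-avoiding permutation of \<open>[n]\<close> is built by inserting a new minimum, \<open>n\<close> times. What follows
  the minimum must increase, so it goes into the last ascending run, cutting off the first \<open>r\<close>
  elements of that run. No consecutive 123 remains iff every \<open>r\<close> is at most 2 and so is the length
  of the final run; hence the length of the last run performs a Motzkin walk with steps \<open>1 - r\<close>,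
  and the descents are the non-up steps. Motzkin paths with a given number of non-up steps are
  counted by the reflection principle, and their generating function is found from the
  quadratic equation of the Motzkin series.
\<close>

unbundle fps_syntax

section \<open>Counting Motzkin paths by their non-up steps\<close>

text \<open>Nonnegative paths from height 0 to height \<open>h\<close> with \<open>n\<close> steps \<open>1, 0, -1\<close>, of which \<open>q\<close> are not
  up-steps.\<close>

fun motzkin_paths :: "nat \<Rightarrow> nat \<Rightarrow> nat \<Rightarrow> nat" where
  "motzkin_paths 0 h q = (if h = 0 \<and> q = 0 then 1 else 0)"
| "motzkin_paths (Suc n) h q =
     (if h = 0 then 0 else motzkin_paths n (h - 1) q)
     + (if q = 0 then 0 else motzkin_paths n h (q - 1) + motzkin_paths n (h + 1) (q - 1))"

lemma kappa_1_0: "kappa 1 N 0 = (if N = 0 then 1 else 0)"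
proof -
  have "{as :: nat list. length as = 0 \<and> (\<forall>a\<in>set as. a \<le> 1) \<and> int (sum_list as) = N}
      = (if N = 0 then {[]} else {})"
    by auto
  then show ?thesis by (simp add: kappa_def)
qed

text \<open>Pascal's rule: the first part is 0 or 1.\<close>

lemma kappa_1_Suc: "kappa 1 N (Suc m) = kappa 1 N m + kappa 1 (N - 1) m"
proof -
  define K where
    "K N m = {as :: nat list. length as = m \<and> (\<forall>a\<in>set as. a \<le> 1) \<and> int (sum_list as) = N}" for N m
  have fin: "finite (K N m)" for N m
  proof (rule finite_subset)
    show "K N m \<subseteq> {as. set as \<subseteq> {..1} \<and> length as = m}" by (auto simp: K_def)
  qed (simp add: finite_lists_length_eq)
  have "K N (Suc m) = (#) 0 ` K N m \<union> (#) 1 ` K (N - 1) m"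
    by (force simp: K_def length_Suc_conv image_iff le_Suc_eq)
  moreover have "(#) 0 ` K N m \<inter> (#) 1 ` K (N - 1) m = {}" by auto
  ultimately have "card (K N (Suc m)) = card (K N m) + card (K (N - 1) m)"
    by (simp add: card_Un_disjoint fin card_image)
  then show ?thesis by (simp add: K_def kappa_def)
qed

text \<open>A composition into parts 0 and 1 is a choice of the places that hold a 1.\<close>

lemma kappa_1_eq_choose: "kappa 1 N m = (if N < 0 then 0 else m choose nat N)"
proof (induction m arbitrary: N)
  case 0
  then show ?case by (simp add: kappa_1_0[unfolded One_nat_def] binomial_eq_0)
next
  case (Suc m)
  show ?case
  proof (cases "N > 0")
    case True
    then obtain k where "nat N = Suc k" "nat (N - 1) = k"
      by (metis Suc_pred nat_0_less_mult_iff nat_diff_distrib' zero_less_nat_eq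
          diff_Suc_1 One_nat_def nat_one_as_int nat_int zero_le_one less_imp_le)
    with True show ?thesis by (simp only: kappa_1_Suc Suc.IH) simp
  next
    case False
    then show ?thesis by (simp only: kappa_1_Suc Suc.IH) auto
  qed
qed

text \<open>The closed form of \<open>motzkin_paths\<close> vanishes at height \<open>-1\<close>, the boundary condition of reflection.\<close>

lemma choose_kappa_boundary:
  "(n choose Suc q) * kappa 1 (int n - int q) (Suc q)
   = (n choose q) * kappa 1 (int n - int q - 1) q"
proof (cases "n \<ge> Suc q")
  case True
  define b where "b = n - Suc q"
  have n: "n = Suc (q + b)" using True by (simp add: b_def)
  \<comment> \<open>Absorption trades the factor \<open>Suc b\<close> for \<open>Suc q\<close> and
    back, so the two products agree up to the factor \<open>Suc b\<close>, which is
    \<open>n - q\<close>.\<close>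
  have "Suc b * (Suc q choose Suc b) = Suc q * (q choose b)"
    by (rule Suc_times_binomial)
  moreover have "Suc q * (n choose Suc q) = Suc b * (n choose q)"
    using binomial_absorb_comp[of n q] binomial_absorption[of q n]
    by (simp add: n)
  ultimately have "Suc b * ((n choose Suc q) * (Suc q choose Suc b)) = Suc b * ((n choose q) * (q choose b))"
    by (metis mult.assoc mult.commute)
  then have "(n choose Suc q) * (Suc q choose Suc b) = (n choose q) * (q choose b)"
    by (simp only: mult_cancel1) simp
  moreover have "nat (int n - int q) = Suc b" "nat (int n - int q - 1) = b" "\<not> int n - int q < 0"
    "\<not> int n - int q - 1 < 0"
    by (auto simp: n)
  ultimately show ?thesis by (simp only: kappa_1_eq_choose if_False)
next
  case False
  then show ?thesis by (auto simp: kappa_1_eq_choose[unfolded One_nat_def] binomial_eq_0)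
qed

text \<open>The first term counts paths without regard to the boundary: choose the places of the
  \<open>q\<close> non-up steps, then the \<open>n - q - h\<close> down-steps among them. The second
  counts those that go below 0: reflecting such a path up to its first visit to height -1 gives it
  one up-step more and one down-step less. The induction needs only the recurrence and the boundary
  value.\<close>

lemma motzkin_paths_closed_form:
  "int (motzkin_paths n h q) =
     int (n choose q) * int (kappa 1 (int n - int q - int h) q)
     - (if q = 0 then 0 else int (n choose (q - 1)) * int (kappa 1 (int n - int q - int h - 1) (q - 1)))"
proof (induction n arbitrary: h q)
  case 0
  then show ?case
    by (auto simp: kappa_1_eq_choose[unfolded One_nat_def] binomial_eq_0)
next
  case (Suc n)
  \<comment> \<open>\<open>F\<close> is the claimed formula for \<open>n\<close> steps, with the
    number \<open>b\<close> of down-steps in place of the height. Removing an up, level or down step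
    leads to \<open>F q b\<close>, \<open>F (q - 1) b\<close> or
    \<open>F (q - 1) (b - 1)\<close>.\<close>
  define F where "F q b = int (n choose q) * int (kappa 1 b q)
     - (if q = 0 then 0 else int (n choose (q - 1)) * int (kappa 1 (b - 1) (q - 1)))" for q b
  define b where "b = int (Suc n) - int q - int h"
  have up: "int (if h = 0 then 0 else motzkin_paths n (h - 1) q) = F q b"
  proof (cases "h = 0")
    case True
    show ?thesis
    proof (cases q)
      case 0
      with True show ?thesis
        by (auto simp: F_def b_def kappa_1_eq_choose[unfolded One_nat_def] binomial_eq_0)
    next
      case (Suc q')
      have "(n choose Suc q') * kappa 1 b (Suc q') = (n choose q') * kappa 1 (b - 1) q'"
        using choose_kappa_boundary[of n q'] True Suc by (simp add: b_def)
      then have "int (n choose Suc q') * int (kappa 1 b (Suc q')) = int (n choose q') * int (kappa 1 (b - 1) q')"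
        by (metis of_nat_mult)
      with Suc True show ?thesis by (simp add: F_def)
    qed
  next
    case False
    then obtain h' where "h = Suc h'" by (cases h) auto
    then show ?thesis using Suc.IH[of h' q]
      by (cases q) (simp_all add: F_def b_def algebra_simps)
  qed
  show ?case
  proof (cases q)
    case 0
    with up show ?thesis by (auto simp: F_def b_def kappa_1_0[unfolded One_nat_def] split: if_splits)
  next
    case (Suc q')
    have lev: "int (motzkin_paths n h q') = F q' b"
      using Suc.IH[of h q'] Suc by (cases q') (simp_all add: F_def b_def algebra_simps)
    have down: "int (motzkin_paths n (h + 1) q') = F q' (b - 1)"
      using Suc.IH[of "h + 1" q'] Suc by (cases q') (simp_all add: F_def b_def algebra_simps)
    have "int (motzkin_paths (Suc n) h q) = F (Suc q') b + F q' b + F q' (b - 1)"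
      using up lev down unfolding motzkin_paths.simps of_nat_add by (simp add: Suc)
    \<comment> \<open>The recurrence of \<open>kappa\<close> merges the level and down terms;
      Pascal's rule then adds the up term.\<close>
    also have "\<dots> = int (Suc n choose q) * int (kappa 1 b q)
        - int (Suc n choose (q - 1)) * int (kappa 1 (b - 1) (q - 1))"
      using Suc
      by (cases q') (simp_all add: F_def kappa_1_Suc[unfolded One_nat_def] algebra_simps)
    finally show ?thesis using Suc by (simp add: b_def)
  qed
qed

text \<open>At height 0, \<open>kappa_1_Suc\<close> splits the first term of the closed form; the
  piece at \<open>n - q - 1\<close> joins the reflected term to give the summand
  \<open>i = 1\<close>.\<close>

lemma motzkin_paths_eq_kappa_sum:
  assumes "q \<ge> 1"
  shows "int (motzkin_paths n 0 q) =
     (\<Sum>i=0..1. (int (n choose q) - int i * int (n choose (q - 1)))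
                     * int (kappa 1 (int n - int q - int i) (q - 1)))"
proof -
  obtain q' where q: "q = Suc q'" using assms by (cases q) auto
  show ?thesis
    unfolding motzkin_paths_closed_form q
    by (simp add: kappa_1_Suc[unfolded One_nat_def] algebra_simps)
qed

section \<open>Path totals and the Motzkin series\<close>

lemma motzkin_paths_eq_0: "n < q \<Longrightarrow> motzkin_paths n h q = 0"
proof (induction n arbitrary: h q)
  case (Suc n)
  then show ?case by simp
qed simp

lemma sum_motzkin_paths_Suc:
  "(\<Sum>q\<le>Suc n. motzkin_paths (Suc n) h q) =
     (if h = 0 then 0 else \<Sum>q\<le>n. motzkin_paths n (h - 1) q)
     + (\<Sum>q\<le>n. motzkin_paths n h q) + (\<Sum>q\<le>n. motzkin_paths n (h + 1) q)"
proof -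
  have "(\<Sum>q\<le>Suc n. motzkin_paths (Suc n) h q) =
     (\<Sum>q\<le>Suc n. if h = 0 then 0 else motzkin_paths n (h - 1) q)
     + (\<Sum>q\<le>Suc n. if q = 0 then 0 else motzkin_paths n h (q - 1) + motzkin_paths n (h + 1) (q - 1))"
    by (simp add: sum.distrib)
  \<comment> \<open>A path of \<open>n\<close> steps has at most \<open>n\<close> non-up steps, so
    the term \<open>q = Suc n\<close> vanishes.\<close>
  also have "(\<Sum>q\<le>Suc n. if h = 0 then 0 else motzkin_paths n (h - 1) q)
      = (if h = 0 then 0 else \<Sum>q\<le>n. motzkin_paths n (h - 1) q)"
    by (simp add: motzkin_paths_eq_0)
  also have "(\<Sum>q\<le>Suc n. if q = 0 then 0 else motzkin_paths n h (q - 1) + motzkin_paths n (h + 1) (q - 1))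
      = (\<Sum>q\<le>n. motzkin_paths n h q) + (\<Sum>q\<le>n. motzkin_paths n (h + 1) q)"
    by (simp add: sum.atMost_Suc_shift sum.distrib del: sum.atMost_Suc)
  finally show ?thesis by simp
qed

text \<open>Solve the definition for the square root, square, and cancel
  \<open>4 * fps_X ^ 2\<close>.\<close>

lemma motzkin_gf_quadratic: "motzkin_gf = 1 + fps_X * motzkin_gf + fps_X\<^sup>2 * motzkin_gf\<^sup>2"
proof -
  define D :: "real fps" where "D = 1 - 2 * fps_X - 3 * fps_X ^ 2"
  define S where "S = fps_radical (\<lambda>k x. root k x) 2 D"
  define N where "N = 1 - fps_X - S"
  have D0: "D $ 0 = 1" and D1: "D $ 1 = -2" by (simp_all add: D_def fps_numeral_nth numeral_fps_const)
  have S2: "S ^ 2 = D"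
    using power_radical[of D "\<lambda>k x. root k x" 1] D0 unfolding S_def by (simp add: numeral_2_eq_2)
  have S0: "S $ 0 = 1" using D0 by (simp add: S_def)
  have "2 * S $ 1 = -2"
    using arg_cong[OF S2, of "\<lambda>f. f $ 1"] D1 S0 by (simp add: power2_eq_square fps_mult_nth)
  then have S1: "S $ 1 = -1" by simp
  have N0: "N $ 0 = 0" "N $ 1 = 0" using S0 S1 by (simp_all add: N_def)
  \<comment> \<open>\<open>N\<close> has no terms of order 0 and 1, so the division in
    \<open>motzkin_gf\<close> is exact and can be undone.\<close>
  have "N = fps_X ^ 2 * fps_shift 2 N"
  proof (rule fps_ext)
    fix n
    consider "n = 0" | "n = 1" | k where "n = Suc (Suc k)"
      by (metis One_nat_def not0_implies_Suc)
    then show "N $ n = (fps_X ^ 2 * fps_shift 2 N) $ n"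
      by cases (simp_all add: fps_X_power_mult_nth N0 N0[unfolded One_nat_def])
  qed
  moreover have "2 * fps_const (1/2) = (1 :: real fps)" by (simp add: numeral_fps_const)
  ultimately have "N = (2 * fps_const (1/2)) * (fps_X ^ 2 * fps_shift 2 N)" by simp
  then have "N = 2 * fps_X ^ 2 * (fps_const (1/2) * fps_shift 2 N)" by (simp only: ac_simps)
  then have "2 * fps_X ^ 2 dvd N" by (rule dvdI)
  moreover have "motzkin_gf = N / (2 * fps_X ^ 2)"
    by (simp add: motzkin_gf_def N_def S_def D_def)
  ultimately have B: "2 * fps_X ^ 2 * motzkin_gf = N"
    by (metis dvd_mult_div_cancel)
  have "(1 - fps_X - 2 * fps_X ^ 2 * motzkin_gf) ^ 2 = D"
    using S2 by (simp add: B N_def)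
  then have "4 * fps_X ^ 2 * (1 + fps_X * motzkin_gf + fps_X\<^sup>2 * motzkin_gf\<^sup>2 - motzkin_gf) = 0"
    unfolding D_def by algebra
  then show ?thesis by (simp add: numeral_fps_const)
qed

text \<open>The series \<open>x^h * B^(h+1)\<close>, with \<open>B\<close> the Motzkin series, satisfy the same last-step
  recurrence as the path counts, by the quadratic equation for \<open>B\<close>.\<close>

lemma fps_nth_motzkin_gf_power:
  "fps_nth (fps_X ^ h * motzkin_gf ^ Suc h) n = real (\<Sum>q\<le>n. motzkin_paths n h q)"
proof (induction n arbitrary: h)
  case 0
  have "motzkin_gf $ 0 = 1" by (subst motzkin_gf_quadratic) simp
  then show ?case by (simp add: fps_mult_nth_0 fps_X_power_nth)
next
  case (Suc n)
  define B where "B = motzkin_gf"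
  have quad: "B = 1 + fps_X * (B + fps_X * B\<^sup>2)"
    using motzkin_gf_quadratic by (simp add: B_def algebra_simps power2_eq_square)
  \<comment> \<open>The quadratic equation replaces just one of the \<open>Suc h\<close>
    factors.\<close>
  have "fps_X ^ h * B ^ Suc h = fps_X ^ h * B ^ h * (1 + fps_X * (B + fps_X * B\<^sup>2))"
    using quad by (metis mult.assoc power_Suc2)
  also have "\<dots> = fps_X ^ h * B ^ h
      + fps_X * (fps_X ^ h * B ^ Suc h + fps_X ^ Suc h * B ^ Suc (Suc h))"
    by (simp add: algebra_simps power2_eq_square)
  finally have "(fps_X ^ h * B ^ Suc h) $ Suc n = (fps_X ^ h * B ^ h
      + fps_X * (fps_X ^ h * B ^ Suc h + fps_X ^ Suc h * B ^ Suc (Suc h))) $ Suc n"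
    by (rule arg_cong)
  then have step: "(fps_X ^ h * B ^ Suc h) $ Suc n = (fps_X ^ h * B ^ h) $ Suc n
      + ((fps_X ^ h * B ^ Suc h) $ n + (fps_X ^ Suc h * B ^ Suc (Suc h)) $ n)"
    by (simp only: fps_add_nth fps_X_mult_nth nat.distinct if_False diff_Suc_1)
  \<comment> \<open>For \<open>h = 0\<close> the series is 1, with coefficient 0 at
    \<open>Suc n\<close>, just as no up-step ends at height 0.\<close>
  have "(fps_X ^ h * B ^ h) $ Suc n = real (if h = 0 then 0 else \<Sum>q\<le>n. motzkin_paths n (h - 1) q)"
  proof (cases h)
    case (Suc h')
    have "fps_X ^ h * B ^ h = fps_X * (fps_X ^ h' * B ^ Suc h')" by (simp add: Suc mult.assoc)
    then have "(fps_X ^ h * B ^ h) $ Suc n = (fps_X ^ h' * B ^ Suc h') $ n"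
      by (simp only: fps_X_mult_nth) simp
    with Suc Suc.IH[of h'] show ?thesis by (simp add: B_def del: power_Suc of_nat_sum)
  qed simp
  with step Suc.IH[of h] Suc.IH[of "Suc h"] show ?case
    unfolding B_def sum_motzkin_paths_Suc by (simp del: power_Suc of_nat_sum sum.atMost_Suc)
qed

lemma motzkin_eq_sum_motzkin_paths: "motzkin n = real (\<Sum>q\<le>n. motzkin_paths n 0 q)"
  using fps_nth_motzkin_gf_power[of 0 n] by (simp add: motzkin_def)

section \<open>Words and the insertion of a new minimum\<close>

text \<open>Permutations are handled as words read from right to left (\<open>word_of\<close> below), so that the last
  ascending run becomes a prefix, and 132 becomes 231.\<close>

fun avoids_231 :: "nat list \<Rightarrow> bool" where
  "avoids_231 [] = True"
| "avoids_231 (x # xs) = (sorted_wrt (\<lambda>y z. \<not> (z < x \<and> x < y)) xs \<and> avoids_231 xs)"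

fun no_double_descent :: "nat list \<Rightarrow> bool" where
  "no_double_descent (x # y # z # xs) = (\<not> (x > y \<and> y > z) \<and> no_double_descent (y # z # xs))"
| "no_double_descent _ = True"

text \<open>Every ascending run of a permutation ends at a descent, the last one at the forced
  descent \<open>n\<close>; after reversal this count is therefore the number of descents.\<close>

fun decreasing_runs :: "nat list \<Rightarrow> nat" where
  "decreasing_runs (x # y # xs) = (if x < y then 1 else 0) + decreasing_runs (y # xs)"
| "decreasing_runs [x] = 1"
| "decreasing_runs [] = 0"

text \<open>A minimum can only be the 1 of a pattern 231, and then the letters before it must
  contain no increasing pair.\<close>

lemma avoids_231_insert_min:
  assumes "\<forall>x\<in>set (us @ ws). m < x" "distinct us"
  shows "avoids_231 (us @ m # ws) \<longleftrightarrow> avoids_231 (us @ ws) \<and> sorted_wrt (>) us"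
  using assms
proof (induction us)
  case Nil
  then have "sorted_wrt (\<lambda>y z. \<not> (z < m \<and> m < y)) ws" by (induction ws) auto
  then show ?case by simp
next
  case (Cons x us)
  then show ?case by (auto simp: sorted_wrt_append not_less order.order_iff_strict)
qed

lemma no_double_descent_min_Cons:
  "\<forall>x\<in>set ws. m < x \<Longrightarrow> no_double_descent (m # ws) = no_double_descent ws"
  by (cases ws rule: no_double_descent.cases) auto

lemma decreasing_runs_min_Cons:
  "\<forall>x\<in>set ws. m < x \<Longrightarrow> decreasing_runs (m # ws) = Suc (decreasing_runs ws)"
  by (cases ws) auto

text \<open>Whatever follows \<open>m\<close> is larger, so \<open>m\<close> could only end a double
  descent, and one letter before it is too few for that.\<close>

lemma no_double_descent_Cons_min_Cons:
  "\<forall>x\<in>set ws. m < x \<Longrightarrow> no_double_descent (x # m # ws) = no_double_descent ws"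
  by (cases ws rule: no_double_descent.cases) auto

text \<open>Intermediate words of the insertion process: \<open>us\<close> is the run that may still be cut (its
  length is the height of the walk), and the runs of \<open>ws\<close> are final. The run of \<open>ws\<close> that was cut off
  last may continue \<open>us\<close> downwards, because the next minimum goes between the two.\<close>

definition split_words :: "nat set \<Rightarrow> nat \<Rightarrow> nat \<Rightarrow> (nat list \<times> nat list) set" where
  "split_words S h q = {(us, ws). length us = h \<and> sorted_wrt (>) us \<and> no_double_descent ws
     \<and> decreasing_runs ws = q \<and> distinct (us @ ws) \<and> set (us @ ws) = S \<and> avoids_231 (us @ ws)}"

text \<open>In each image \<open>m\<close> is appended to the open run, and then
  \<open>r = 0\<close>, 1 or 2 letters are cut off its end; if \<open>r > 0\<close> they form a new
  final run at the front of \<open>ws\<close>. These are the up, level and down steps.\<close>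

lemma split_words_insert_min:
  assumes m: "\<forall>x\<in>S. m < x"
  shows "split_words (insert m S) h q =
     (if h = 0 then {} else (\<lambda>(us, ws). (us @ [m], ws)) ` split_words S (h - 1) q)
     \<union> (if q = 0 then {} else
          (\<lambda>(us, ws). (us, m # ws)) ` split_words S h (q - 1)
          \<union> (\<lambda>(us, ws). (butlast us, last us # m # ws)) ` split_words S (h + 1) (q - 1))"
    (is "?L = ?A \<union> ?B")
proof (intro equalityI subsetI)
  fix p assume "p \<in> ?L"
  then obtain us ws where p: "p = (us, ws)" and len: "length us = h" and dec: "sorted_wrt (>) us"
    and nd: "no_double_descent ws" and q: "decreasing_runs ws = q" and dist: "distinct (us @ ws)"
    and set: "set (us @ ws) = insert m S" and av: "avoids_231 (us @ ws)"
    by (auto simp: split_words_def)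
  have "m \<notin> S" using m by auto
  consider "m \<in> set us" | "m \<in> set ws" using set by auto
  then show "p \<in> ?A \<union> ?B"
  proof cases
    case 1
    then obtain us1 us2 where us: "us = us1 @ m # us2" by (meson split_list)
    have "us2 = []"
    proof (rule ccontr)
      assume "us2 \<noteq> []"
      then obtain y where y: "y \<in> set us2" by (cases us2) auto
      then have "y < m" using dec by (auto simp: us sorted_wrt_append)
      moreover have "y \<in> S" using y set dist by (auto simp: us)
      ultimately show False using m by auto
    qed
    then have us: "us = us1 @ [m]" using us by simp
    have S: "set (us1 @ ws) = S" using set dist \<open>m \<notin> S\<close> by (auto simp: us)
    have "avoids_231 (us1 @ ws)"
      using avoids_231_insert_min[of us1 ws m] av m S dist by (simp add: us)
    then have "(us1, ws) \<in> split_words S (h - 1) q"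
      using len dec nd q dist S by (auto simp: split_words_def us sorted_wrt_append)
    moreover have "h \<noteq> 0" using len us by auto
    ultimately show ?thesis by (force simp: p us)
  next
    case 2
    then obtain w1 w2 where ws: "ws = w1 @ m # w2" by (meson split_list)
    have S: "set (us @ w1 @ w2) = S" using set dist \<open>m \<notin> S\<close> by (auto simp: ws)
    have av': "avoids_231 (us @ w1 @ w2)" and dec': "sorted_wrt (>) (us @ w1)"
      using avoids_231_insert_min[of "us @ w1" w2 m] av m S dist by (auto simp: ws)
    have w2: "\<forall>x\<in>set w2. m < x" using S m by auto
    \<comment> \<open>The letters of \<open>w1\<close> decrease towards \<open>m\<close>, so two or
      more of them would create a double descent in \<open>ws\<close>.\<close>
    consider "w1 = []" | x where "w1 = [x]" | x y w3 where "w1 = x # y # w3"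
      by (metis neq_Nil_conv)
    then show ?thesis
    proof cases
      case 1
      then have ws: "ws = m # w2" using ws by simp
      have "(us, w2) \<in> split_words S h (q - 1)" "q \<noteq> 0"
        using nd q av' dist S len dec w2 1
        by (auto simp: split_words_def ws no_double_descent_min_Cons decreasing_runs_min_Cons)
      then show ?thesis by (force simp: p ws)
    next
      case (2 x)
      then have ws: "ws = x # m # w2" using ws by simp
      have "m < x" using S m 2 by auto
      then have "(us @ [x], w2) \<in> split_words S (h + 1) (q - 1)" "q \<noteq> 0"
        using nd q av' dist S len dec' w2 2
        by (auto simp: split_words_def ws no_double_descent_Cons_min_Cons decreasing_runs_min_Cons)
      then show ?thesis by (force simp: p ws)
    next
      case (3 x y w3)
      have "x > y" using dec' 3 by (simp add: sorted_wrt_append)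
      \<comment> \<open>\<open>hd (w3 @ [m])\<close> is the letter after \<open>y\<close>, whether
        or not \<open>w3\<close> is empty.\<close>
      moreover have "y > hd (w3 @ [m])"
        using dec' 3 S m by (cases w3) (auto simp: sorted_wrt_append)
      ultimately have "\<not> no_double_descent ws"
        by (cases w3) (auto simp: ws 3)
      then show ?thesis using nd by simp
    qed
  qed
next
  fix p assume "p \<in> ?A \<union> ?B"
  then consider
      us ws where "h \<noteq> 0" "p = (us @ [m], ws)" "(us, ws) \<in> split_words S (h - 1) q"
    | us ws where "q \<noteq> 0" "p = (us, m # ws)" "(us, ws) \<in> split_words S h (q - 1)"
    | us ws where "q \<noteq> 0" "p = (butlast us, last us # m # ws)" "(us, ws) \<in> split_words S (h + 1) (q - 1)"
    by (auto split: if_splits)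
  then show "p \<in> ?L"
  proof cases
    case 1
    then show ?thesis using m avoids_231_insert_min[of us ws m]
      by (auto simp: split_words_def sorted_wrt_append)
  next
    case 2
    then show ?thesis using m avoids_231_insert_min[of us ws m]
      by (auto simp: split_words_def no_double_descent_min_Cons decreasing_runs_min_Cons)
  next
    case 3
    \<comment> \<open>The length of \<open>us\<close> is \<open>h + 1\<close>, so
      \<open>last us\<close> is a genuine letter.\<close>
    then obtain vs x where us: "us = vs @ [x]" by (cases us rule: rev_cases) (auto simp: split_words_def)
    have "x \<in> S" using 3 us by (auto simp: split_words_def)
    then have "m < x" using m by simp
    then show ?thesis using 3 m avoids_231_insert_min[of "vs @ [x]" ws m]
      by (auto simp: us split_words_def no_double_descent_Cons_min_Cons decreasing_runs_min_Cons sorted_wrt_append)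
  qed
qed

text \<open>The place of \<open>m\<close> reveals the last step: in \<open>us\<close>, at the head
  of \<open>ws\<close>, or just behind that head. Hence the three images are disjoint and their
  sizes add up to the path recurrence.\<close>

lemma card_split_words:
  assumes "finite S"
  shows "finite (split_words S h q) \<and> card (split_words S h q) = motzkin_paths (card S) h q"
  using assms
\<comment> \<open>The elements of \<open>S\<close> enter from the largest down, so each new one is
  the minimum.\<close>
proof (induction S arbitrary: h q rule: finite_linorder_min_induct)
  case empty
  have "split_words {} h q = (if h = 0 \<and> q = 0 then {([], [])} else {})"
    by (auto simp: split_words_def)
  then show ?case by simp
next
  case (insert m S)
  define A where "A = (if h = 0 then {} else (\<lambda>(us, ws). (us @ [m], ws)) ` split_words S (h - 1) q)"
  define B where "B = (if q = 0 then {} else (\<lambda>(us, ws). (us, m # ws)) ` split_words S h (q - 1))"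
  define C where "C = (if q = 0 then {} else
    (\<lambda>(us, ws). (butlast us, last us # m # ws)) ` split_words S (h + 1) (q - 1))"
  have m: "m \<notin> S" using insert.hyps by auto
  have eq: "split_words (insert m S) h q = A \<union> (B \<union> C)"
    using split_words_insert_min[OF insert.hyps(2), of h q] by (simp add: A_def B_def C_def)
  have fin: "finite A" "finite B" "finite C"
    using insert.IH by (auto simp: A_def B_def C_def)
  have memS: "set us \<subseteq> S \<and> set ws \<subseteq> S" if "(us, ws) \<in> split_words S h' q'" for us ws h' q'
    using that by (auto simp: split_words_def)
  have A: "m \<in> set us" if "(us, ws) \<in> A" for us ws
    using that by (auto simp: A_def split: if_splits)
  have B: "m \<notin> set us \<and> hd ws = m" if "(us, ws) \<in> B" for us ws
    using that m by (auto simp: B_def dest!: memS split: if_splits)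
  have C: "m \<notin> set us \<and> hd ws \<noteq> m" if uw: "(us, ws) \<in> C" for us ws
  proof -
    obtain vs xs where vx: "(vs, xs) \<in> split_words S (h + 1) (q - 1)" "us = butlast vs"
      "ws = last vs # m # xs"
      using uw by (auto simp: C_def split: if_splits)
    then have "vs \<noteq> []" by (auto simp: split_words_def)
    then have "last vs \<in> S" using vx memS by (meson last_in_set subsetD)
    moreover have "set us \<subseteq> S" using vx memS by (meson in_set_butlastD subsetD subsetI)
    ultimately show ?thesis using m vx by auto
  qed
  have "B \<inter> C = {}" using B C by auto
  moreover have "A \<inter> (B \<union> C) = {}" using A B C by fast
  ultimately have "card (split_words (insert m S) h q) = card A + (card B + card C)"
    using fin by (simp add: eq card_Un_disjoint)
  moreover have "inj_on (\<lambda>(us, ws). (us @ [m], ws)) (split_words S (h - 1) q)"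
    by (auto simp: inj_on_def)
  then have "card A = (if h = 0 then 0 else motzkin_paths (card S) (h - 1) q)"
    using insert.IH by (auto simp: A_def card_image)
  moreover have "inj_on (\<lambda>(us, ws). (us, m # ws)) (split_words S h (q - 1))"
    by (auto simp: inj_on_def)
  then have "card B = (if q = 0 then 0 else motzkin_paths (card S) h (q - 1))"
    using insert.IH by (auto simp: B_def card_image)
  moreover have "inj_on (\<lambda>(us, ws). (butlast us, last us # m # ws)) (split_words S (h + 1) (q - 1))"
  proof (rule inj_onI, clarify)
    fix us ws us' ws'
    assume "(us, ws) \<in> split_words S (h + 1) (q - 1)" "(us', ws') \<in> split_words S (h + 1) (q - 1)"
      and eq: "butlast us = butlast us'" "last us = last us'"
    then have "us \<noteq> []" "us' \<noteq> []" by (auto simp: split_words_def)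
    then show "us = us' \<and> ws = ws" using eq by (metis append_butlast_last_id)
  qed
  then have "card C = (if q = 0 then 0 else motzkin_paths (card S) (h + 1) (q - 1))"
    using insert.IH by (auto simp: C_def card_image)
  ultimately show ?case
    using fin eq m insert.hyps by simp
qed

section \<open>Translating permutations into words\<close>

definition word_of :: "nat \<Rightarrow> (nat \<Rightarrow> nat) \<Rightarrow> nat list" where
  "word_of n \<pi> = map \<pi> (rev [1..<Suc n])"

lemma word_of_0: "word_of 0 \<pi> = []"
  by (simp add: word_of_def)

lemma word_of_Suc: "word_of (Suc n) \<pi> = \<pi> (Suc n) # word_of n \<pi>"
  by (simp add: word_of_def)

lemma sorted_wrt_upt_iff: "sorted_wrt P [1..<Suc n] \<longleftrightarrow> (\<forall>a b. 1 \<le> a \<and> a < b \<and> b \<le> n \<longrightarrow> P a b)"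
  proof (induction n)
  case (Suc n)
  have "sorted_wrt P [1..<Suc (Suc n)] \<longleftrightarrow> sorted_wrt P [1..<Suc n] \<and> (\<forall>a\<in>{1..<Suc n}. P a (Suc n))"
    by (subst upt_Suc) (simp add: sorted_wrt_append del: upt_Suc)
  then show ?case unfolding Suc by (auto simp: le_Suc_eq less_Suc_eq_le)
qed simp

text \<open>The head of the word is the last value, so the test against it concerns the occurrences
  of 132 that end at index \<open>Suc n\<close>.\<close>

lemma avoids_231_word_of: "avoids_231 (word_of n \<pi>) \<longleftrightarrow> avoids_132 n \<pi>"
proof (induction n)
  case 0
  then show ?case by (simp add: word_of_0 avoids_132_def)
next
  case (Suc n)
  have "avoids_231 (word_of (Suc n) \<pi>) \<longleftrightarrow>
     (\<forall>a b. 1 \<le> a \<and> a < b \<and> b \<le> n \<longrightarrow> \<not> (\<pi> a < \<pi> (Suc n) \<and> \<pi> (Suc n) < \<pi> b)) \<and> avoids_132 n \<pi>"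
    using Suc by (simp add: word_of_Suc) (simp add: word_of_def sorted_wrt_map sorted_wrt_rev sorted_wrt_upt_iff[unfolded One_nat_def] del: upt_Suc)
  also have "\<dots> \<longleftrightarrow> avoids_132 (Suc n) \<pi>"
  proof -
    have "(\<exists>c. b < c \<and> c \<le> Suc n \<and> P c) \<longleftrightarrow> (\<exists>c. b < c \<and> c \<le> n \<and> P c) \<or> (b \<le> n \<and> P (Suc n))" for b P
      by (metis le_Suc_eq less_Suc_eq_le)
    then show ?thesis unfolding avoids_132_def by simp blast
  qed
  finally show ?case .
qed

lemma no_double_descent_word_of: "no_double_descent (word_of n \<pi>) \<longleftrightarrow> avoids_consecutive_123 n \<pi>"
proof (induction n)
  case 0
  then show ?case by (simp add: word_of_0 avoids_consecutive_123_def)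
next
  case (Suc n)
  consider "n = 0" | "n = 1" | k where "n = Suc (Suc k)"
    by (metis One_nat_def not0_implies_Suc)
  then show ?case
  proof cases
    case (3 k)
    have "avoids_consecutive_123 (Suc n) \<pi> \<longleftrightarrow>
      \<not> (\<pi> (Suc k) < \<pi> n \<and> \<pi> n < \<pi> (Suc n)) \<and> avoids_consecutive_123 n \<pi>"
      by (auto simp: avoids_consecutive_123_def 3 le_Suc_eq)
    with Suc 3 show ?thesis by (auto simp: word_of_Suc)
  qed (auto simp: word_of_Suc word_of_0 avoids_consecutive_123_def)
qed

lemma decreasing_runs_word_of: "decreasing_runs (word_of n \<pi>) = card (descents n \<pi>)"
proof (cases n)
  case 0
  then show ?thesis by (simp add: word_of_0 descents_def)
next
  case (Suc k)
  \<comment> \<open>The forced descent moves as the word grows, so the induction counts the other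
    descents and adds 1 for it.\<close>
  have "decreasing_runs (word_of (Suc k) \<pi>) = Suc (card {a \<in> {1..k}. \<pi> a > \<pi> (a + 1)})"
  proof (induction k)
    case 0
    then show ?case by (simp add: word_of_Suc word_of_0)
  next
    case (Suc k)
    have "{a \<in> {1..Suc k}. \<pi> a > \<pi> (a + 1)} =
      (if \<pi> (Suc k) > \<pi> (Suc (Suc k)) then insert (Suc k) {a \<in> {1..k}. \<pi> a > \<pi> (a + 1)}
       else {a \<in> {1..k}. \<pi> a > \<pi> (a + 1)})"
      by (auto simp: le_Suc_eq)
    with Suc show ?case by (simp add: word_of_Suc)
  qed
  moreover have "descents n \<pi> = insert (Suc k) {a \<in> {1..k}. \<pi> a > \<pi> (a + 1)}"
    by (auto simp: descents_def Suc le_Suc_eq)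
  ultimately show ?thesis by (simp add: Suc)
qed

lemma bij_betw_word_of:
  "bij_betw (word_of n) {\<pi>. \<pi> permutes {1..n}} {xs. distinct xs \<and> set xs = {1..n}}"
proof (rule bij_betwI')
  fix \<pi> \<rho> :: "nat \<Rightarrow> nat"
  assume perm: "\<pi> \<in> {\<pi>. \<pi> permutes {1..n}}" "\<rho> \<in> {\<pi>. \<pi> permutes {1..n}}"
  show "word_of n \<pi> = word_of n \<rho> \<longleftrightarrow> \<pi> = \<rho>"
  proof
    assume "word_of n \<pi> = word_of n \<rho>"
    then have "\<forall>x\<in>{1..n}. \<pi> x = \<rho> x" by (auto simp: word_of_def simp del: upt_Suc)
    then show "\<pi> = \<rho>" using perm by (metis ext mem_Collect_eq permutes_not_in)
  qed simp
next
  fix \<pi> :: "nat \<Rightarrow> nat"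
  assume perm: "\<pi> \<in> {\<pi>. \<pi> permutes {1..n}}"
  then have "inj \<pi>" by (simp add: permutes_inj)
  then have "inj_on \<pi> {1..<Suc n}" by (rule inj_on_subset) simp
  moreover have "\<pi> ` {1..<Suc n} = {1..n}"
    using perm by (simp add: permutes_image atLeastLessThanSuc_atLeastAtMost)
  ultimately show "word_of n \<pi> \<in> {xs. distinct xs \<and> set xs = {1..n}}"
    by (simp add: word_of_def distinct_map del: upt_Suc)
next
  fix xs :: "nat list"
  assume "xs \<in> {xs. distinct xs \<and> set xs = {1..n}}"
  then have xs: "distinct xs" "set xs = {1..n}" by auto
  then have len: "length xs = n" by (metis card_atLeastAtMost diff_Suc_1 distinct_card)
  \<comment> \<open>The word is reversed and list positions start at 0, so the value at
    \<open>i\<close> stands at position \<open>n - i\<close>.\<close>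
  define \<pi> where "\<pi> = (\<lambda>i. if i \<in> {1..n} then xs ! (n - i) else i)"
  have word: "word_of n \<pi> = xs"
    by (rule nth_equalityI) (auto simp: word_of_def len rev_nth \<pi>_def simp del: upt_Suc)
  have "\<pi> ` {1..n} = {1..n}"
    using arg_cong[OF word, of set] xs(2)
    by (simp add: word_of_def atLeastLessThanSuc_atLeastAtMost del: upt_Suc)
  then have "bij_betw \<pi> {1..n} {1..n}"
    by (simp add: bij_betw_def eq_card_imp_inj_on)
  then have "\<pi> permutes {1..n}" by (rule bij_imp_permutes) (auto simp: \<pi>_def)
  with word show "\<exists>\<pi>\<in>{\<pi>. \<pi> permutes {1..n}}. xs = word_of n \<pi>" by blast
qed

text \<open>A complete word corresponds to an empty open run: all its runs are final, and the walk
  is back at height 0.\<close>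

lemma card_perms_avoiding:
  "card {\<pi> \<in> perms_avoiding_132 n. avoids_consecutive_123 n \<pi> \<and> card (descents n \<pi>) = q}
   = motzkin_paths n 0 q"
proof -
  let ?P = "{\<pi> \<in> perms_avoiding_132 n. avoids_consecutive_123 n \<pi> \<and> card (descents n \<pi>) = q}"
  define Q where "Q xs \<longleftrightarrow> avoids_231 xs \<and> no_double_descent xs \<and> decreasing_runs xs = q" for xs
  have P: "?P = {\<pi> \<in> {\<pi>. \<pi> permutes {1..n}}. Q (word_of n \<pi>)}"
    by (auto simp: Q_def perms_avoiding_132_def avoids_231_word_of no_double_descent_word_of
        decreasing_runs_word_of)
  have "inj_on (word_of n) ?P"
    by (rule inj_on_subset[OF bij_betw_imp_inj_on[OF bij_betw_word_of]]) (auto simp: P)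
  then have "inj_on (\<lambda>\<pi>. ([] :: nat list, word_of n \<pi>)) ?P"
    by (simp add: inj_on_def)
  then have "card ?P = card ((\<lambda>\<pi>. ([] :: nat list, word_of n \<pi>)) ` ?P)"
    by (rule card_image[symmetric])
  also have "(\<lambda>\<pi>. ([] :: nat list, word_of n \<pi>)) ` ?P
      = Pair [] ` {xs \<in> word_of n ` {\<pi>. \<pi> permutes {1..n}}. Q xs}"
    unfolding P by auto
  also have "\<dots> = split_words {1..n} 0 q"
    unfolding bij_betw_imp_surj_on[OF bij_betw_word_of]
  proof (intro set_eqI)
    fix p :: "nat list \<times> nat list"
    obtain us ws where "p = (us, ws)" by (cases p)
    then show "p \<in> Pair [] ` {xs \<in> {xs. distinct xs \<and> set xs = {1..n}}. Q xs}
        \<longleftrightarrow> p \<in> split_words {1..n} 0 q"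
      by (cases us) (simp_all add: split_words_def Q_def image_iff conj_ac)
  qed
  also have "card \<dots> = motzkin_paths n 0 q"
    using card_split_words[of "{1..n}" 0 q] by simp
  finally show ?thesis .
qed

theorem corollary5p5:
  fixes n :: nat
  assumes "n \<ge> 1"
  shows
    "(\<forall>q\<ge>1.
        int (card {\<pi> \<in> perms_avoiding_132 n.
                     avoids_consecutive_123 n \<pi> \<and> card (descents n \<pi>) = q})
        = (\<Sum>i=0..1. (int (n choose q) - int i * int (n choose (q - 1)))
                     * int (kappa 1 (int n - int q - int i) (q - 1))))
     \<and> motzkin n =
        real_of_int (\<Sum>q=1..n. \<Sum>i=0..1. (int (n choose q) - int i * int (n choose (q - 1)))
                     * int (kappa 1 (int n - int q - int i) (q - 1)))"
proof
  show "\<forall>q\<ge>1.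
        int (card {\<pi> \<in> perms_avoiding_132 n.
                     avoids_consecutive_123 n \<pi> \<and> card (descents n \<pi>) = q})
        = (\<Sum>i=0..1. (int (n choose q) - int i * int (n choose (q - 1)))
                     * int (kappa 1 (int n - int q - int i) (q - 1)))"
    by (intro allI impI) (simp only: card_perms_avoiding motzkin_paths_eq_kappa_sum)
  \<comment> \<open>With up-steps only, the walk ends at height \<open>n\<close>, which is positive;
    so the sum may start at \<open>q = 1\<close>.\<close>
  have "int (motzkin_paths n 0 0) = 0"
    using assms by (simp only: motzkin_paths_closed_form kappa_1_0) simp
  moreover have "{..n} = insert 0 {1..n}" by auto
  ultimately have "motzkin n = real (\<Sum>q=1..n. motzkin_paths n 0 q)"
    by (simp add: motzkin_eq_sum_motzkin_paths)
  also have "\<dots> = real_of_int (\<Sum>q=1..n. int (motzkin_paths n 0 q))" by simp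
  also have "(\<Sum>q=1..n. int (motzkin_paths n 0 q)) =
      (\<Sum>q=1..n. \<Sum>i=0..1. (int (n choose q) - int i * int (n choose (q - 1)))
                     * int (kappa 1 (int n - int q - int i) (q - 1)))"
    by (rule sum.cong[OF refl], rule motzkin_paths_eq_kappa_sum) simp
  finally show "motzkin n =
        real_of_int (\<Sum>q=1..n. \<Sum>i=0..1. (int (n choose q) - int i * int (n choose (q - 1)))
                     * int (kappa 1 (int n - int q - int i) (q - 1)))" .
qed

end
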